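(* Let $p_0,p_1,p_2\ge 0$ with $p_0+p_1+p_2=1$ and $\min(p_1,p_2)>0$, and let $y_0,y_1,y_2\in\mathbb{R}$. Let $\boldsymbol{x}=(x_1,x_2)$ be a random vector with $$\Pr(\boldsymbol{x}=(0,0))=p_0,\qquad \Pr(\boldsymbol{x}=(1,0))=p_1,\qquad \Pr(\boldsymbol{x}=(0,1))=p_2,$$ and let $y=f(\boldsymbol{x})$ with $f(0,0)=y_0$, $f(1,0)=y_1$, $f(0,1)=y_2$. Assume $\sigma^2=\operatorname{var}(y)>0$. Then the Shapley relative importance $\phi_1/\sigma^2$ of variable $x_1$ is $$\frac{\phi_1}{\sigma^2}=\frac12\Bigl(1+\frac{p_0}{\sigma^2}\times\frac{p_1(1-p_1)\bar y_1^2-p_2(1-p_2)\bar y_2^2}{(1-p_1)(1-p_2)}\Bigr),$$ where $\bar y_j=y_j-y_0$ for $j=1,2$.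
   Context: Shapley value: for a random vector $\boldsymbol{x}=(x_1,\dots,x_d)$ and a real-valued $f$ with $\mathbb{E}(f(\boldsymbol{x})^2)<\infty$, put $\operatorname{val}(u)=\operatorname{var}(\mathbb{E}(f(\boldsymbol{x})\mid\boldsymbol{x}_u))$ for $u\subseteq\{1,\dots,d\}$, where $\boldsymbol{x}_u=(x_i)_{i\in u}$ (so $\operatorname{val}(\varnothing)=0$). The Shapley value of variable $j$ is $$\phi_j=\frac1d\sum_{u\subseteq\{1,\dots,d\}\setminus\{j\}}\binom{d-1}{|u|}^{-1}\bigl(\operatorname{val}(u\cup\{j\})-\operatorname{val}(u)\bigr).$$ Here $d=2$. The Shapley relative importance of $x_j$ is $\phi_j/\sigma^2$ with $\sigma^2=\operatorname{var}(f(\boldsymbol{x}))$. *)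

theory Defs
  imports "HOL-Probability.Probability"
begin

context prob_space
begin

text \<open>The \<sigma>-algebra on \<^term>\<open>space M\<close> generated by the subvector of the components of
  \<open>X\<close> with index in \<open>u\<close>. For \<open>u = {}\<close> the product space has a single point, so the generated
  \<sigma>-algebra is the trivial one.\<close>

definition subvector_sigma :: "('a \<Rightarrow> real ^ 'n) \<Rightarrow> 'n set \<Rightarrow> 'a measure" where
  "subvector_sigma X u =
     vimage_algebra (space M) (\<lambda>\<omega>. \<lambda>i\<in>u. X \<omega> $ i) (\<Pi>\<^sub>M i\<in>u. (borel :: real measure))"

definition shapley_val :: "('a \<Rightarrow> real ^ 'n) \<Rightarrow> (real ^ 'n \<Rightarrow> real) \<Rightarrow> 'n set \<Rightarrow> real" where
  "shapley_val X f u = variance (real_cond_exp M (subvector_sigma X u) (\<lambda>\<omega>. f (X \<omega>)))"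

text \<open>The number of variables is \<^term>\<open>CARD('n)\<close>.\<close>

definition shapley :: "('a \<Rightarrow> real ^ 'n) \<Rightarrow> (real ^ 'n \<Rightarrow> real) \<Rightarrow> 'n::finite \<Rightarrow> real" where
  "shapley X f j =
     1 / real CARD('n) *
     (\<Sum>u\<in>Pow (UNIV - {j}).
        inverse (real ((CARD('n) - 1) choose card u)) *
        (shapley_val X f (u \<union> {j}) - shapley_val X f u))"

end

end

theory Submission
  imports Defs
begin

text \<open>If \<open>X\<close> is concentrated on a finite set, then \<open>E(f(X) | X\<^sub>u)\<close> is the weighted average of \<open>f\<close> over
  the support points that agree with \<open>X\<close> on \<open>u\<close>. For the three points at hand, conditioning on
  \<open>x\<^sub>1\<close> merges only \<open>(0,0)\<close> and \<open>(0,1)\<close>, and conditioning on \<open>x\<^sub>2\<close> merges only \<open>(0,0)\<close> and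
  \<open>(1,0)\<close>. Since \<open>val({}) = 0\<close> and \<open>val({1,2}) = \<sigma>\<^sup>2\<close>, we get
  \<open>\<phi>\<^sub>1 = (\<sigma>\<^sup>2 + val({1}) - val({2})) / 2\<close>, and merging \<open>(0,0)\<close> with the point of weight \<open>p\<^sub>j\<close> lowers
  the variance by \<open>p\<^sub>0 p\<^sub>j (y\<^sub>j - y\<^sub>0)\<^sup>2 / (p\<^sub>0 + p\<^sub>j)\<close>.\<close>

context prob_space
begin

lemma finite_range_AE:
  fixes X :: "'a \<Rightarrow> 'b::t1_space"
  assumes X: "X \<in> borel_measurable M"
    and S: "finite S" "(\<Sum>a\<in>S. prob {\<omega>\<in>space M. X \<omega> = a}) = 1"
  shows "AE \<omega> in M. X \<omega> \<in> S"
proof -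
  have meas: "{\<omega>\<in>space M. X \<omega> = a} \<in> events" for a
    using X by measurable
  have "prob (\<Union>a\<in>S. {\<omega>\<in>space M. X \<omega> = a}) = (\<Sum>a\<in>S. prob {\<omega>\<in>space M. X \<omega> = a})"
    using S(1) meas by (intro finite_measure_finite_Union) (auto simp: disjoint_family_on_def)
  hence "prob (\<Union>a\<in>S. {\<omega>\<in>space M. X \<omega> = a}) = 1"
    using S(2) by simp
  hence "AE \<omega> in M. \<omega> \<in> (\<Union>a\<in>S. {\<omega>\<in>space M. X \<omega> = a})"
    using S(1) meas by (subst AE_in_set_eq_1) auto
  thus ?thesis by eventually_elim auto
qed

text \<open>Almost surely \<open>X\<close> lies in \<open>S\<close>, so \<open>h\<close> agrees
  almost everywhere with a finite combination of indicators of level sets. Letting \<open>h\<close>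
  depend on the sample point covers integrands cut off by the indicator of an event.\<close>

lemma has_bochner_integral_finite_range:
  fixes X :: "'a \<Rightarrow> 'b::t1_space" and h :: "'a \<Rightarrow> real"
  assumes X: "X \<in> borel_measurable M" and h: "h \<in> borel_measurable M"
    and S: "finite S" "(\<Sum>a\<in>S. prob {\<omega>\<in>space M. X \<omega> = a}) = 1"
    and hy: "\<And>\<omega>. \<omega> \<in> space M \<Longrightarrow> X \<omega> \<in> S \<Longrightarrow> h \<omega> = y (X \<omega>)"
  shows "has_bochner_integral M h (\<Sum>a\<in>S. prob {\<omega>\<in>space M. X \<omega> = a} * y a)"
proof -
  have meas: "{\<omega>\<in>space M. X \<omega> = a} \<in> events" for a
    using X by measurable
  let ?k = "\<lambda>\<omega>. \<Sum>a\<in>S. indicator {\<omega>\<in>space M. X \<omega> = a} \<omega> * y a"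
  have k: "has_bochner_integral M ?k (\<Sum>a\<in>S. prob {\<omega>\<in>space M. X \<omega> = a} * y a)"
    by (intro has_bochner_integral_sum has_bochner_integral_mult_left
        has_bochner_integral_real_indicator meas) (simp add: emeasure_eq_measure)
  have "AE \<omega> in M. h \<omega> = ?k \<omega>"
    using finite_range_AE[OF X S] AE_space
  proof eventually_elim
    case (elim \<omega>)
    have "?k \<omega> = (\<Sum>a\<in>S. if a = X \<omega> then y a else 0)"
      using elim by (intro sum.cong) (auto simp: indicator_def)
    thus ?case using S(1) elim by (simp add: hy)
  qed
  thus ?thesis
    using k h by (subst has_bochner_integral_cong_AE[where g="?k"])
      (auto intro: borel_measurable_has_bochner_integral)
qed

lemma variance_finite_range:
  fixes X :: "'a \<Rightarrow> 'b::t1_space" and h :: "'a \<Rightarrow> real"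
  assumes X: "X \<in> borel_measurable M" and h: "h \<in> borel_measurable M"
    and S: "finite S" "(\<Sum>a\<in>S. prob {\<omega>\<in>space M. X \<omega> = a}) = 1"
    and hy: "\<And>\<omega>. \<omega> \<in> space M \<Longrightarrow> X \<omega> \<in> S \<Longrightarrow> h \<omega> = y (X \<omega>)"
  shows "variance h = (\<Sum>a\<in>S. prob {\<omega>\<in>space M. X \<omega> = a} * (y a)\<^sup>2)
    - (\<Sum>a\<in>S. prob {\<omega>\<in>space M. X \<omega> = a} * y a)\<^sup>2"
proof -
  have 1: "has_bochner_integral M h (\<Sum>a\<in>S. prob {\<omega>\<in>space M. X \<omega> = a} * y a)"
    by (rule has_bochner_integral_finite_range[OF X h S hy])
  have 2: "has_bochner_integral M (\<lambda>\<omega>. (h \<omega>)\<^sup>2) (\<Sum>a\<in>S. prob {\<omega>\<in>space M. X \<omega> = a} * (y a)\<^sup>2)"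
    using h by (intro has_bochner_integral_finite_range[OF X _ S]) (auto simp: hy)
  show ?thesis
    using 1 2 by (subst variance_eq) (auto simp: has_bochner_integral_iff)
qed

text \<open>\<open>C u a\<close> is the class of support points that \<open>u\<close> cannot tell
  apart from \<open>a\<close>, and the squared quotient is the class average of \<open>f\<close>.
  The variance is then the second moment minus the squared mean, which averaging preserves.\<close>

lemma shapley_val_finite_range:
  fixes X :: "'a \<Rightarrow> real ^ 'n::finite" and S :: "(real ^ 'n) set"
  defines "p \<equiv> \<lambda>a. prob {\<omega>\<in>space M. X \<omega> = a}"
    and "C \<equiv> \<lambda>u a. {b\<in>S. \<forall>k\<in>u. b $ k = a $ k}"
  assumes X: "X \<in> borel_measurable M" and fX: "(\<lambda>\<omega>. f (X \<omega>)) \<in> borel_measurable M"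
    and S: "finite S" "(\<Sum>a\<in>S. p a) = 1"
  shows "shapley_val X f u =
    (\<Sum>a\<in>S. p a * ((\<Sum>b\<in>C u a. p b * f b) / (\<Sum>b\<in>C u a. p b))\<^sup>2) - (\<Sum>a\<in>S. p a * f a)\<^sup>2"
proof -
  define N where "N = (\<Pi>\<^sub>M i\<in>u. (borel :: real measure))"
  define F where "F = subvector_sigma X u"
  define r where "r = (\<lambda>a :: real ^ 'n. \<lambda>i\<in>u. a $ i)"
  define q where "q = (\<lambda>t. \<Sum>b\<in>{b\<in>S. r b = t}. p b)"
  \<comment> \<open>A level set of weight 0 gets the junk value \<open>c t = 0\<close>; there both sides of \<open>block\<close> below vanish.\<close>
  define c where "c = (\<lambda>t. (\<Sum>b\<in>{b\<in>S. r b = t}. p b * f b) / q t)"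
  define G where "G = (\<lambda>t. \<Sum>s\<in>r ` S. c s * indicator {s} t)"
  have S': "(\<Sum>a\<in>S. prob {\<omega>\<in>space M. X \<omega> = a}) = 1"
    using S by (simp add: p_def)
  have p0: "p a \<ge> 0" for a by (simp add: p_def)
  have "(\<lambda>\<omega>. X \<omega> $ i) \<in> borel_measurable M" for i
    by (intro measurable_compose[OF X] borel_measurable_continuous_onI continuous_intros)
  hence rX: "(\<lambda>\<omega>. r (X \<omega>)) \<in> measurable M N"
    unfolding r_def N_def by (intro measurable_restrict) auto
  have F_eq: "F = vimage_algebra (space M) (\<lambda>\<omega>. r (X \<omega>)) N"
    by (simp add: F_def subvector_sigma_def r_def N_def)
  have rN: "(\<lambda>\<omega>. r (X \<omega>)) \<in> space M \<rightarrow> space N"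
    using measurable_space[OF rX] by auto
  have sub: "subalgebra M F"
    unfolding subalgebra_def F_eq using rX
    by (auto simp: sets_vimage_algebra2[OF rN] measurable_sets)
  have singleton: "{s} \<in> sets N" if "s \<in> r ` S" for s
  proof -
    have "{s} = PiE u (\<lambda>i. {s i})"
      using that by (intro PiE_singleton[symmetric]) (auto simp: r_def)
    thus ?thesis by (simp add: N_def sets_PiM_I_finite)
  qed
  have GN: "G \<in> borel_measurable N"
    unfolding G_def
    by (intro borel_measurable_sum borel_measurable_times borel_measurable_const
        borel_measurable_indicator singleton)
  have Gr: "G (r a) = c (r a)" if "a \<in> S" for a
    using that S(1) by (simp add: G_def indicator_def if_distrib[of "\<lambda>x. _ * x"] cong: if_cong)
  have gF: "(\<lambda>\<omega>. G (r (X \<omega>))) \<in> borel_measurable F"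
    unfolding F_eq by (rule measurable_compose[OF measurable_vimage_algebra1[OF rN] GN])
  have gM: "(\<lambda>\<omega>. G (r (X \<omega>))) \<in> borel_measurable M"
    by (rule measurable_compose[OF rX GN])
  \<comment> \<open>Replacing \<open>f\<close> by its class average preserves the weighted sum over
    each class.\<close>
  have block: "(\<Sum>a\<in>{a\<in>S. r a = t}. p a * f a) = (\<Sum>a\<in>{a\<in>S. r a = t}. p a * G (r a))" for t
  proof (cases "q t = 0")
    case True
    hence "p a = 0" if "a \<in> {a\<in>S. r a = t}" for a
      using that S(1) unfolding q_def by (subst (asm) sum_nonneg_eq_0_iff) (auto simp: p0)
    thus ?thesis by simp
  next
    case False
    have "(\<Sum>a\<in>{a\<in>S. r a = t}. p a * G (r a)) = (\<Sum>a\<in>{a\<in>S. r a = t}. p a * c t)"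
      by (intro sum.cong) (auto simp: Gr)
    also have "\<dots> = q t * c t" by (simp add: q_def sum_distrib_right)
    also have "\<dots> = (\<Sum>a\<in>{a\<in>S. r a = t}. p a * f a)" using False by (simp add: c_def)
    finally show ?thesis ..
  qed
  \<comment> \<open>The indicator of \<open>B\<close> at \<open>r a\<close> is constant on each
    class, so the equality per class sums up to this one.\<close>
  have sum_B: "(\<Sum>a\<in>S. p a * (indicator B (r a) * f a)) =
      (\<Sum>a\<in>S. p a * (indicator B (r a) * G (r a)))" for B :: "('n \<Rightarrow> real) set"
  proof -
    have "(\<Sum>a\<in>S. p a * (indicator B (r a) * k a)) =
        (\<Sum>t\<in>r ` S. indicator B t * (\<Sum>a\<in>{a\<in>S. r a = t}. p a * k a))" for k
      by (subst sum.image_gen[OF S(1), of _ r])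
        (intro sum.cong refl, simp add: sum_distrib_left mult.left_commute)
    thus ?thesis by (simp add: block)
  qed
  interpret F: finite_measure_subalgebra M F
    using sub by unfold_locales
  \<comment> \<open>Every set of \<open>F\<close> is the preimage of some \<open>B\<close> under the
    subvector map, so the defining integral identity of the conditional expectation reduces to
    \<open>sum_B\<close>.\<close>
  have ae: "AE \<omega> in M. real_cond_exp M F (\<lambda>\<omega>. f (X \<omega>)) \<omega> = G (r (X \<omega>))"
  proof (rule F.real_cond_exp_charact)
    fix A assume "A \<in> sets F"
    then obtain B where A: "A = (\<lambda>\<omega>. r (X \<omega>)) -` B \<inter> space M"
      unfolding F_eq by (auto simp: sets_vimage_algebra2[OF rN])
    have AM: "A \<in> events"
      using \<open>A \<in> sets F\<close> sub by (auto simp: subalgebra_def)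
    have "has_bochner_integral M (\<lambda>\<omega>. indicator A \<omega> * f (X \<omega>))
        (\<Sum>a\<in>S. p a * (indicator B (r a) * f a))"
      unfolding p_def
      by (intro has_bochner_integral_finite_range[OF X _ S(1) S'] borel_measurable_times
          borel_measurable_indicator fX AM) (auto simp: A indicator_def)
    moreover have "has_bochner_integral M (\<lambda>\<omega>. indicator A \<omega> * G (r (X \<omega>)))
        (\<Sum>a\<in>S. p a * (indicator B (r a) * G (r a)))"
      unfolding p_def
      by (intro has_bochner_integral_finite_range[OF X _ S(1) S'] borel_measurable_times
          borel_measurable_indicator gM AM) (auto simp: A indicator_def)
    ultimately show "(LINT \<omega>:A|M. f (X \<omega>)) = (LINT \<omega>:A|M. G (r (X \<omega>)))"
      by (simp add: set_lebesgue_integral_def has_bochner_integral_iff sum_B)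
  next
    show "integrable M (\<lambda>\<omega>. f (X \<omega>))"
      using has_bochner_integral_finite_range[OF X fX S(1) S', where y = f]
      by (auto simp: has_bochner_integral_iff)
    show "integrable M (\<lambda>\<omega>. G (r (X \<omega>)))"
      using has_bochner_integral_finite_range[OF X gM S(1) S', where y = "\<lambda>a. G (r a)"]
      by (auto simp: has_bochner_integral_iff)
  qed (fact gF)
  \<comment> \<open>The variance contains this expectation inside its integrand, so it is replaced
    before the almost-everywhere congruence.\<close>
  have mean: "expectation (real_cond_exp M F (\<lambda>\<omega>. f (X \<omega>))) = expectation (\<lambda>\<omega>. G (r (X \<omega>)))"
    using ae gM by (intro integral_cong_AE) auto
  have "shapley_val X f u = variance (\<lambda>\<omega>. G (r (X \<omega>)))"
    unfolding shapley_val_def F_def[symmetric] mean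
    using ae gM by (intro integral_cong_AE) auto
  also have "\<dots> = (\<Sum>a\<in>S. p a * (G (r a))\<^sup>2) - (\<Sum>a\<in>S. p a * G (r a))\<^sup>2"
    unfolding p_def by (rule variance_finite_range[OF X gM S(1) S']) simp
  \<comment> \<open>Taking \<open>B = UNIV\<close> gives the law of total expectation.\<close>
  also have "(\<Sum>a\<in>S. p a * G (r a)) = (\<Sum>a\<in>S. p a * f a)"
    using sum_B[of UNIV] by simp
  also have "(\<Sum>a\<in>S. p a * (G (r a))\<^sup>2) =
      (\<Sum>a\<in>S. p a * ((\<Sum>b\<in>C u a. p b * f b) / (\<Sum>b\<in>C u a. p b))\<^sup>2)"
  proof -
    have "{b\<in>S. r b = r a} = C u a" for a
      by (auto simp: C_def r_def restrict_def fun_eq_iff)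
    thus ?thesis by (intro sum.cong) (simp_all add: Gr c_def q_def)
  qed
  finally show ?thesis .
qed

end

theorem theorem3:
  fixes M :: "'a measure"
    and X :: "'a \<Rightarrow> real ^ 2"
    and f :: "real ^ 2 \<Rightarrow> real"
    and p0 p1 p2 y0 y1 y2 \<sigma>2 :: real
  assumes "prob_space M"
    and "X \<in> borel_measurable M"
    and "(\<lambda>\<omega>. f (X \<omega>)) \<in> borel_measurable M"
    and "p0 \<ge> 0" "p1 \<ge> 0" "p2 \<ge> 0"
    and "p0 + p1 + p2 = 1"
    and "min p1 p2 > 0"
    and "measure M {\<omega> \<in> space M. X \<omega> = vector [0, 0]} = p0"
    and "measure M {\<omega> \<in> space M. X \<omega> = vector [1, 0]} = p1"
    and "measure M {\<omega> \<in> space M. X \<omega> = vector [0, 1]} = p2"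
    and "f (vector [0, 0]) = y0"
    and "f (vector [1, 0]) = y1"
    and "f (vector [0, 1]) = y2"
    and "\<sigma>2 = prob_space.variance M (\<lambda>\<omega>. f (X \<omega>))"
    and "\<sigma>2 > 0"
  shows "prob_space.shapley M X f 1 / \<sigma>2 =
    1 / 2 * (1 + p0 / \<sigma>2 *
      ((p1 * (1 - p1) * (y1 - y0)\<^sup>2 - p2 * (1 - p2) * (y2 - y0)\<^sup>2) / ((1 - p1) * (1 - p2))))"
proof -
  interpret prob_space M by fact
  note X = assms(2) and fX = assms(3)
  define S :: "(real ^ 2) set" where "S = {vector [0, 0], vector [1, 0], vector [0, 1]}"
  define m where "m = p0 * y0 + p1 * y1 + p2 * y2"
  have ne: "vector [0, 0] \<noteq> (vector [1, 0] :: real ^ 2)" "vector [0, 0] \<noteq> (vector [0, 1] :: real ^ 2)"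
    "vector [1, 0] \<noteq> (vector [0, 1] :: real ^ 2)"
    by (simp_all add: vec_eq_iff forall_2)
  have sum_S: "sum g S = g (vector [0, 0]) + g (vector [1, 0]) + g (vector [0, 1])"
    for g :: "real ^ 2 \<Rightarrow> real"
    using ne by (simp add: S_def)
  have S: "finite S" "(\<Sum>a\<in>S. prob {\<omega>\<in>space M. X \<omega> = a}) = 1"
    using assms by (simp add: S_def, simp add: sum_S)
  have pos: "p1 > 0" "p2 > 0" "p0 + p1 > 0" "p0 + p2 > 0"
    using assms by auto
  \<comment> \<open>Sums over classes become conditional sums over \<open>S\<close>, which
    \<open>sum_S\<close> expands into three terms.\<close>
  note val = shapley_val_finite_range[OF X fX S, unfolded sum.inter_filter[OF S(1)] sum_S]
  have val_empty: "shapley_val X f {} = 0"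
    unfolding val using assms(7,9-14) by (simp flip: distrib_right)
  have var: "\<sigma>2 = p0 * y0\<^sup>2 + p1 * y1\<^sup>2 + p2 * y2\<^sup>2 - m\<^sup>2"
    unfolding assms(15) using assms(9-14)
    by (subst variance_finite_range[OF X fX S, where y = f]) (simp_all add: sum_S m_def)
  \<comment> \<open>All classes are singletons. If \<open>p0 = 0\<close>, the quotient for the
    origin is 0 by convention, and its term vanishes as it should.\<close>
  have val_full: "shapley_val X f {1, 2} = \<sigma>2"
    unfolding val var using assms(9-14) pos
    by (simp add: m_def power2_eq_square)
  have val_1: "shapley_val X f {1} = (p0 * y0 + p2 * y2)\<^sup>2 / (p0 + p2) + p1 * y1\<^sup>2 - m\<^sup>2"
  proof -
    have "shapley_val X f {1} = (p0 + p2) * ((p0 * y0 + p2 * y2) / (p0 + p2))\<^sup>2 + p1 * y1\<^sup>2 - m\<^sup>2"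
      unfolding val using assms(9-14) pos by (simp add: m_def algebra_simps)
    thus ?thesis using pos by (simp add: power2_eq_square)
  qed
  have val_2: "shapley_val X f {2} = (p0 * y0 + p1 * y1)\<^sup>2 / (p0 + p1) + p2 * y2\<^sup>2 - m\<^sup>2"
  proof -
    have "shapley_val X f {2} = (p0 + p1) * ((p0 * y0 + p1 * y1) / (p0 + p1))\<^sup>2 + p2 * y2\<^sup>2 - m\<^sup>2"
      unfolding val using assms(9-14) pos by (simp add: m_def algebra_simps)
    thus ?thesis using pos by (simp add: power2_eq_square)
  qed
  \<comment> \<open>Only \<open>{}\<close> and \<open>{2}\<close> occur in the Shapley sum, both
    with binomial coefficient 1.\<close>
  have "(UNIV :: 2 set) - {1} = {2}"
    by (simp add: UNIV_2)
  hence "shapley X f 1 = 1 / 2 * (shapley_val X f {1} - shapley_val X f {} +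
      (shapley_val X f {1, 2} - shapley_val X f {2}))"
    by (simp add: shapley_def Pow_insert Un_insert_left)
  also have "\<dots> = 1 / 2 * (\<sigma>2 + (shapley_val X f {1} - shapley_val X f {2}))"
    by (simp add: val_empty val_full)
  also have "shapley_val X f {1} - shapley_val X f {2} =
      p0 * p1 / (p0 + p1) * (y1 - y0)\<^sup>2 - p0 * p2 / (p0 + p2) * (y2 - y0)\<^sup>2"
  proof -
    \<comment> \<open>This is the loss of second moment from merging two points. In the difference
      of the two values, \<open>m\<^sup>2\<close> and the unmerged second moments cancel.\<close>
    have id: "(p0 * y0 + q * y)\<^sup>2 / (p0 + q) =
        p0 * y0\<^sup>2 + q * y\<^sup>2 - p0 * q / (p0 + q) * (y - y0)\<^sup>2" if "p0 + q > 0" for q y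
      using that by (simp add: field_simps power2_eq_square)
    show ?thesis unfolding val_1 val_2 id[OF pos(3)] id[OF pos(4)] by simp
  qed
  also have "\<dots> = p0 * ((p1 * (1 - p1) * (y1 - y0)\<^sup>2 - p2 * (1 - p2) * (y2 - y0)\<^sup>2) / ((1 - p1) * (1 - p2)))"
  proof -
    \<comment> \<open>The total weight 1 turns the two merged weights into the denominators of the
      claim.\<close>
    have compl: "1 - p2 = p0 + p1" "1 - p1 = p0 + p2"
      using assms(7) by auto
    show ?thesis
      unfolding compl using pos(3,4) by (simp add: field_simps)
  qed
  finally show ?thesis
    using \<open>\<sigma>2 > 0\<close> by (simp add: add_divide_distrib)
qed

end
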